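(* Let $s \geq 2$ be an integer. Then the limit $\overline{\alpha_s}=\lim_{N\to\infty} g_s(N)/N$ exists and \[\overline{\alpha_s} = 1-\left(\prod_{p\leq s} \frac{p-1}{p}\right) \sum_{j\in I_s} \frac{1}{n_j},\] the product being over primes $p\le s$. Furthermore, \[\overline{\alpha_s} = \sup\{\bar{d}(A):A \subset \mathbb{N} \text{ contains no three-term rational geometric progression whose ratio involves only the primes at most } s\}.\]
   Context: A three-term (rational) geometric progression is a triple $(a, ak, ak^2)$ of positive integers with $k\in\mathbb{Q}$, $k>1$; its ratio involves only the primes at most $s$ if $k=u/v$ with $u,v$ positive $s$-smooth integers (all prime factors $\le s$). $g_s(N)$ is the cardinality of the largest subset of $\{1,\dots,N\}$ containing no such progression with ratio involving only primes at most $s$. Let $1=n_1<n_2<\cdots$ be the $s$-smooth positive integers in increasing order. For each $j$, $m_j$ is the size of the largest subset of $\{n_1,\dots,n_j\}$ containing no three terms in geometric progression (i.e. no distinct $x,y,z$ with $xz=y^2$). $I_s$ is the set of indices $j\ge 2$ with $m_j=m_{j-1}$. $\bar d$ denotes upper density. *)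

theory Defs
  imports "HOL-Analysis.Analysis" "HOL-Computational_Algebra.Primes"
begin

definition smooth_nats :: "nat \<Rightarrow> nat set" where
  "smooth_nats s = {n. n > 0 \<and> (\<forall>p. prime p \<longrightarrow> p dvd n \<longrightarrow> p \<le> s)}"

definition contains_smooth_ratio_gp :: "nat \<Rightarrow> nat set \<Rightarrow> bool" where
  "contains_smooth_ratio_gp s A \<longleftrightarrow>
     (\<exists>a\<in>A. \<exists>b\<in>A. \<exists>c\<in>A. \<exists>k::rat. \<exists>u\<in>smooth_nats s. \<exists>v\<in>smooth_nats s.
        0 < a \<and> 1 < k \<and> k = of_nat u / of_nat v \<and>
        of_nat b = of_nat a * k \<and> of_nat c = of_nat a * k ^ 2)"

definition g :: "nat \<Rightarrow> nat \<Rightarrow> nat" where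
  "g s N = Max {card A | A. A \<subseteq> {1..N} \<and> \<not> contains_smooth_ratio_gp s A}"

text \<open>
  The enumeration of the smooth numbers is 1-based, so that \<open>nth_smooth s 1 = 1\<close>, whereas
  \<^const>\<open>enumerate\<close> starts at 0; the value at index 0 is never used.
  The smooth numbers form an infinite set for \<open>s \<ge> 2\<close>, as \<^const>\<open>enumerate\<close> requires.
\<close>

definition nth_smooth :: "nat \<Rightarrow> nat \<Rightarrow> nat" where
  "nth_smooth s j = enumerate (smooth_nats s) (j - 1)"

lemma infinite_smooth_nats:
  assumes "s \<ge> 2"
  shows "infinite (smooth_nats s)"
proof -
  have "p \<le> s" if "prime p" "p dvd 2 ^ k" for p k :: nat
    using prime_dvd_power[OF that] assms by (auto dest: dvd_imp_le)
  then have "range (\<lambda>k::nat. 2 ^ k) \<subseteq> smooth_nats s"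
    by (auto simp: smooth_nats_def)
  moreover have "infinite (range (\<lambda>k::nat. (2::nat) ^ k))"
    by (intro range_inj_infinite injI) simp
  ultimately show ?thesis
    by (rule infinite_super)
qed

definition three_gp_free :: "nat set \<Rightarrow> bool" where
  "three_gp_free B \<longleftrightarrow>
     \<not> (\<exists>x\<in>B. \<exists>y\<in>B. \<exists>z\<in>B. x \<noteq> y \<and> y \<noteq> z \<and> x \<noteq> z \<and> x * z = y ^ 2)"

definition m :: "nat \<Rightarrow> nat \<Rightarrow> nat" where
  "m s j = Max {card B | B. B \<subseteq> nth_smooth s ` {1..j} \<and> three_gp_free B}"

definition stationary_indices :: "nat \<Rightarrow> nat set" where
  "stationary_indices s = {j. 2 \<le> j \<and> m s j = m s (j - 1)}"

definition upper_density :: "nat set \<Rightarrow> ereal" where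
  "upper_density A = limsup (\<lambda>N. ereal (real (card (A \<inter> {1..N})) / real N))"

end

theory Submission
  imports Defs
begin

text \<open>
  Every positive integer is uniquely \<open>r * t\<close> with \<open>r\<close> free of primes at most \<open>s\<close> and \<open>t\<close> smooth, and
  a forbidden progression keeps \<open>r\<close> constant, so each fibre over \<open>r\<close> can be optimised on its own.
  The optimum on the smooth numbers up to \<open>n\<close> grows by one at each smooth number that is not
  stationary. Hence \<open>N - g s N\<close> is the sum, over the stationary smooth \<open>t\<close>, of the number of rough
  integers up to \<open>N / t\<close>. As the rough integers have density \<open>\<Prod>(p - 1) / p\<close>, dominated convergence
  with dominating terms \<open>1 / t\<close> gives the limit; the convergence of \<open>\<Sum> 1 / t\<close> over all smooth \<open>t\<close> comes
  from the same count, with every smooth number in place of the stationary ones.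

  For the supremum, let \<open>f\<close> grow so fast that \<open>f i\<close> times the number of smooth integers up to
  \<open>f (i + 1)\<close> is \<open>o(f (i + 1))\<close>. Fill each fibre with \<open>f i < r \<le> f (i + 1)\<close> by a set that is optimal
  for the cutoff \<open>f (i + 1)\<close>. Different stages use different fibres, so they cannot interact, and
  along \<open>f\<close> the union has density tending to \<open>lim g s N / N\<close>.
\<close>

section \<open>Density of the integers without small prime factors\<close>

definition indivisible_nats :: "nat set \<Rightarrow> nat set" where
  "indivisible_nats F = {n. n > 0 \<and> (\<forall>p\<in>F. \<not> p dvd n)}"

definition rough_nats :: "nat \<Rightarrow> nat set" where
  "rough_nats s = indivisible_nats {p. prime p \<and> p \<le> s}"

definition rough_density :: "nat \<Rightarrow> real" where
  "rough_density s = (\<Prod>p\<in>{p::nat. prime p \<and> p \<le> s}. (real p - 1) / real p)"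

lemma real_div_nat_bounds:
  fixes n p :: nat
  assumes "p > 0"
  shows "real (n div p) \<le> real n / real p" "real n / real p - 1 \<le> real (n div p)"
proof -
  have "real n / real p = real (n div p) + real (n mod p) / real p"
  proof -
    have "real n = real p * real (n div p) + real (n mod p)"
      by (metis mult_div_mod_eq of_nat_add of_nat_mult)
    then show ?thesis
      using assms by (simp add: field_simps)
  qed
  moreover have "real (n mod p) / real p \<le> 1"
    using assms by simp
  ultimately show "real (n div p) \<le> real n / real p" "real n / real p - 1 \<le> real (n div p)"
    by (simp_all del: of_nat_div)
qed

text \<open>The members lost on adding \<open>p\<close> are exactly the products
  \<open>p * k\<close> with \<open>k \<le> n div p\<close> counted for \<open>F\<close>: as
  \<open>p\<close> differs from the primes in \<open>F\<close>, multiplication by \<open>p\<close>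
  creates no divisor in \<open>F\<close>.\<close>

lemma card_indivisible_insert:
  assumes "\<And>q. q \<in> F \<Longrightarrow> prime q" "prime p" "p \<notin> F"
  shows "card (indivisible_nats F \<inter> {1..n}) =
    card (indivisible_nats (insert p F) \<inter> {1..n}) + card (indivisible_nats F \<inter> {1..n div p})"
proof -
  have p: "p > 0" using assms(2) by (simp add: prime_gt_0_nat)
  let ?C = "(*) p ` (indivisible_nats F \<inter> {1..n div p})"
  have ndvd: "\<not> q dvd p * k" if "q \<in> F" "\<not> q dvd k" for q k
    using that assms by (metis prime_dvd_mult_iff primes_dvd_imp_eq)
  have "indivisible_nats F \<inter> {1..n} = (indivisible_nats (insert p F) \<inter> {1..n}) \<union> ?C"
  proof (intro equalityI subsetI)
    fix x assume x: "x \<in> indivisible_nats F \<inter> {1..n}"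
    show "x \<in> (indivisible_nats (insert p F) \<inter> {1..n}) \<union> ?C"
    proof (cases "p dvd x")
      case True
      then obtain k where k: "x = p * k" by blast
      have "k \<in> indivisible_nats F \<inter> {1..n div p}"
        using x p unfolding k
        by (auto simp: indivisible_nats_def less_eq_div_iff_mult_less_eq Suc_le_eq mult.commute)
      then show ?thesis using k by blast
    qed (use x in \<open>auto simp: indivisible_nats_def\<close>)
  next
    fix x assume "x \<in> (indivisible_nats (insert p F) \<inter> {1..n}) \<union> ?C"
    then show "x \<in> indivisible_nats F \<inter> {1..n}"
      using ndvd p
      by (auto simp: indivisible_nats_def less_eq_div_iff_mult_less_eq Suc_le_eq mult.commute)
  qed
  moreover have "(indivisible_nats (insert p F) \<inter> {1..n}) \<inter> ?C = {}"
    by (auto simp: indivisible_nats_def)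
  moreover have "card ?C = card (indivisible_nats F \<inter> {1..n div p})"
    using p by (intro card_image inj_onI) auto
  ultimately show ?thesis
    by (simp add: card_Un_disjoint)
qed

text \<open>Induction on the set of primes with a bounded error. A new prime at most doubles the
  error and adds the rounding of \<open>n / p\<close>; only independence of \<open>n\<close>
  matters.\<close>

lemma card_indivisible_bound:
  assumes "finite F" "\<And>q. q \<in> F \<Longrightarrow> prime q"
  shows "\<exists>C. \<forall>n. \<bar>real (card (indivisible_nats F \<inter> {1..n}))
    - real n * (\<Prod>p\<in>F. (real p - 1) / real p)\<bar> \<le> C"
  using assms
proof (induction F rule: finite_induct)
  case empty
  have "indivisible_nats {} \<inter> {1..n} = {1..n}" for n
    by (auto simp: indivisible_nats_def)
  then show ?case by auto
next
  case (insert p F)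
  let ?D = "\<Prod>p\<in>F. (real p - 1) / real p"
  let ?c = "\<lambda>F n. real (card (indivisible_nats F \<inter> {1..n}))"
  obtain C where C: "\<And>n. \<bar>?c F n - real n * ?D\<bar> \<le> C"
    using insert by auto
  have p: "p > 0" using insert.prems by (simp add: prime_gt_0_nat)
  have "\<bar>?c (insert p F) n - real n * (\<Prod>p\<in>insert p F. (real p - 1) / real p)\<bar>
      \<le> C + C + \<bar>?D\<bar>" for n
  proof -
    have "?c F n = ?c (insert p F) n + ?c F (n div p)"
      using card_indivisible_insert[of F p n] insert by simp
    moreover have "real n * (\<Prod>p\<in>insert p F. (real p - 1) / real p)
        = real n * ?D - (real n / real p) * ?D"
      using insert.hyps p by (simp add: field_simps)
    \<comment> \<open>Three errors: the one for \<open>F\<close> at \<open>n\<close>, the one for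
      \<open>F\<close> at \<open>n div p\<close>, and the replacement of \<open>n / p\<close> by its
      floor.\<close>
    ultimately have split: "?c (insert p F) n - real n * (\<Prod>p\<in>insert p F. (real p - 1) / real p)
      = (?c F n - real n * ?D) - (?c F (n div p) - real (n div p) * ?D)
        + (real n / real p - real (n div p)) * ?D"
      by (simp add: algebra_simps)
    have e: "\<bar>(real n / real p - real (n div p)) * ?D\<bar> \<le> \<bar>?D\<bar>"
      unfolding abs_mult using real_div_nat_bounds[OF p, of n]
      by (intro mult_left_le_one_le) auto
    have triangle: "x = a - b + e \<Longrightarrow> \<bar>e\<bar> \<le> d \<Longrightarrow> \<bar>a\<bar> \<le> C \<Longrightarrow> \<bar>b\<bar> \<le> C \<Longrightarrow> \<bar>x\<bar> \<le> C + C + d"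
      for x a b e d :: real
      by linarith
    show ?thesis
      by (rule triangle[OF split e C C])
  qed
  then show ?case by blast
qed

lemma finite_primes_le: "finite {p::nat. prime p \<and> p \<le> s}"
  by (rule finite_subset[of _ "{..s}"]) auto

lemma rough_density_pos: "rough_density s > 0"
  unfolding rough_density_def
  by (intro prod_pos) (auto dest: prime_gt_1_nat prime_gt_0_nat)

lemma tendsto_card_rough_div:
  assumes "t > 0"
  shows "(\<lambda>n. real (card (rough_nats s \<inter> {1..n div t})) / real n) \<longlonglongrightarrow> rough_density s / real t"
proof -
  let ?c = "\<lambda>n. real (card (rough_nats s \<inter> {1..n}))"
  obtain C where C: "\<And>n. \<bar>?c n - real n * rough_density s\<bar> \<le> C"
    using card_indivisible_bound[OF finite_primes_le[of s]]
    unfolding rough_nats_def rough_density_def by auto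
  have "(\<lambda>n. ?c (n div t) / real n - rough_density s / real t) \<longlonglongrightarrow> 0"
  proof (rule Lim_null_comparison)
    show "(\<lambda>n. (C + rough_density s) / real n) \<longlonglongrightarrow> 0"
      by (rule lim_const_over_n)
    show "\<forall>\<^sub>F n in sequentially. norm (?c (n div t) / real n - rough_density s / real t)
        \<le> (C + rough_density s) / real n"
      using eventually_gt_at_top[of 0]
    proof eventually_elim
      case (elim n)
      let ?e = "(real n / real t - real (n div t)) * rough_density s"
      have "\<bar>?e\<bar> \<le> rough_density s"
        unfolding abs_mult using real_div_nat_bounds[OF assms, of n] rough_density_pos[of s]
        by (subst (2) abs_of_pos) (auto intro!: mult_left_le_one_le)
      then have "\<bar>?c (n div t) - real n / real t * rough_density s\<bar> \<le> C + rough_density s"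
        using C[of "n div t"] by (simp add: algebra_simps)
      moreover have "?c (n div t) / real n - rough_density s / real t
          = (?c (n div t) - real n / real t * rough_density s) / real n"
        using elim by (simp add: field_simps)
      ultimately show ?case
        using elim by (simp add: divide_right_mono)
    qed
  qed
  then show ?thesis
    by (simp add: LIM_zero_iff)
qed

section \<open>Factorisation into a rough and a smooth part\<close>

lemma smooth_nats_pos: "t \<in> smooth_nats s \<Longrightarrow> t > 0"
  and rough_nats_pos: "r \<in> rough_nats s \<Longrightarrow> r > 0"
  by (auto simp: smooth_nats_def rough_nats_def indivisible_nats_def)

lemma one_smooth: "1 \<in> smooth_nats s"
  by (auto simp: smooth_nats_def)

lemma smooth_mult:
  "a \<in> smooth_nats s \<Longrightarrow> b \<in> smooth_nats s \<Longrightarrow> a * b \<in> smooth_nats s"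
  by (auto simp: smooth_nats_def prime_dvd_mult_iff)

lemma coprime_rough_smooth:
  assumes "r \<in> rough_nats s" "t \<in> smooth_nats s"
  shows "coprime r t"
proof (rule ccontr)
  assume "\<not> coprime r t"
  then have "gcd r t \<noteq> 1" by (simp add: coprime_iff_gcd_eq_1)
  then obtain p where "prime p" "p dvd gcd r t"
    using prime_factor_nat by blast
  then show False
    using assms by (auto simp: smooth_nats_def rough_nats_def indivisible_nats_def)
qed

text \<open>By coprimality with the opposite smooth part, each rough part divides the other.\<close>

lemma rough_smooth_unique:
  assumes "r \<in> rough_nats s" "r' \<in> rough_nats s" "t \<in> smooth_nats s" "t' \<in> smooth_nats s"
    and eq: "r * t = r' * t'"
  shows "r = r' \<and> t = t'"
proof -
  have "r dvd r' * t'" "r' dvd r * t"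
    using eq by (metis dvd_triv_left)+
  then have "r dvd r'" "r' dvd r"
    using coprime_rough_smooth assms coprime_dvd_mult_left_iff by blast+
  then have "r = r'" by (rule dvd_antisym)
  then show ?thesis using eq rough_nats_pos[OF assms(2)] by simp
qed

text \<open>Strong induction, moving one prime factor at most \<open>s\<close> at a time into the
  smooth part.\<close>

lemma rough_smooth_exists:
  assumes "n > 0"
  shows "\<exists>r\<in>rough_nats s. \<exists>t\<in>smooth_nats s. n = r * t"
  using assms
proof (induction n rule: less_induct)
  case (less n)
  show ?case
  proof (cases "n \<in> rough_nats s")
    case True
    then show ?thesis using one_smooth by force
  next
    case False
    then obtain p where p: "prime p" "p \<le> s" "p dvd n"
      using less.prems by (auto simp: rough_nats_def indivisible_nats_def)
    then obtain k where k: "n = p * k" by blast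
    have "k < n" "k > 0"
      using k less.prems prime_gt_1_nat[OF p(1)] by auto
    then obtain r t where rt: "r \<in> rough_nats s" "t \<in> smooth_nats s" "k = r * t"
      using less.IH by blast
    have "p \<in> smooth_nats s"
      using p by (auto simp: smooth_nats_def prime_gt_0_nat dest: primes_dvd_imp_eq)
    then have "p * t \<in> smooth_nats s" "n = r * (p * t)"
      using rt k by (auto intro: smooth_mult)
    then show ?thesis using rt by blast
  qed
qed

text \<open>Multiplication is a bijection from the pairs of a rough and a smooth number onto the
  positive integers; the pairs are grouped by the rough part.\<close>

lemma card_rough_fibres:
  assumes "A \<subseteq> {1..}"
  shows "card (A \<inter> {1..N}) =
    (\<Sum>r\<in>rough_nats s \<inter> {1..N}. card {t \<in> smooth_nats s \<inter> {1..N div r}. r * t \<in> A})"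
proof -
  let ?F = "\<lambda>r. {t \<in> smooth_nats s \<inter> {1..N div r}. r * t \<in> A}"
  let ?X = "SIGMA r:rough_nats s \<inter> {1..N}. ?F r"
  have inj: "inj_on (\<lambda>(r, t). r * t) ?X"
    by (auto simp: inj_on_def dest: rough_smooth_unique)
  have "(\<lambda>(r, t). r * t) ` ?X = A \<inter> {1..N}"
  proof (intro equalityI subsetI)
    fix x assume "x \<in> A \<inter> {1..N}"
    then have x: "x \<in> A" "x > 0" "x \<le> N" by auto
    obtain r t where rt: "r \<in> rough_nats s" "t \<in> smooth_nats s" "x = r * t"
      using rough_smooth_exists x by blast
    then have pos: "r > 0" "t > 0" using x by auto
    then have "r \<le> r * t" by simp
    then have "(r, t) \<in> ?X"
      using rt x pos le_trans[OF \<open>r \<le> r * t\<close>]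
      by (auto simp: less_eq_div_iff_mult_less_eq mult.commute)
    then show "x \<in> (\<lambda>(r, t). r * t) ` ?X" using rt by force
  next
    fix x assume "x \<in> (\<lambda>(r, t). r * t) ` ?X"
    then show "x \<in> A \<inter> {1..N}"
      by (auto simp: less_eq_div_iff_mult_less_eq mult.commute Suc_le_eq)
  qed
  then have "card (A \<inter> {1..N}) = card ?X"
    using card_image[OF inj] by simp
  also have "\<dots> = (\<Sum>r\<in>rough_nats s \<inter> {1..N}. card (?F r))"
    by (intro card_SigmaI) auto
  finally show ?thesis .
qed

section \<open>Progression-free sets of smooth numbers\<close>

text \<open>The extremal number behind \<open>m\<close>, with the cutoff given as a value instead of
  an index, so that it can be taken at \<open>N div r\<close> whether or not that is smooth.\<close>

definition max_free :: "nat \<Rightarrow> nat \<Rightarrow> nat" where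
  "max_free s n = Max {card B | B. B \<subseteq> smooth_nats s \<inter> {1..n} \<and> three_gp_free B}"

lemma finite_card_subsets:
  assumes "finite X"
  shows "finite {card B | B. B \<subseteq> X \<and> P B}"
  using assms by (rule_tac finite_subset[of _ "card ` Pow X"]) auto

lemma card_le_max_free:
  assumes "B \<subseteq> smooth_nats s \<inter> {1..n}" "three_gp_free B"
  shows "card B \<le> max_free s n"
  unfolding max_free_def using assms
  by (intro Max_ge finite_card_subsets) auto

lemma max_free_attained:
  obtains B where "B \<subseteq> smooth_nats s \<inter> {1..n}" "three_gp_free B" "card B = max_free s n"
proof -
  let ?X = "{card B | B. B \<subseteq> smooth_nats s \<inter> {1..n} \<and> three_gp_free B}"
  have "card ({} :: nat set) \<in> ?X"
    by (auto simp: three_gp_free_def intro!: exI[of _ "{}"])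
  then have "Max ?X \<in> ?X"
    by (intro Max_in finite_card_subsets) auto
  then show thesis using that unfolding max_free_def by auto
qed

lemma three_gp_free_subset: "three_gp_free B \<Longrightarrow> C \<subseteq> B \<Longrightarrow> three_gp_free C"
  unfolding three_gp_free_def by blast

lemma max_free_0: "max_free s 0 = 0"
proof -
  obtain B where "B \<subseteq> smooth_nats s \<inter> {1..0}" "card B = max_free s 0"
    using max_free_attained[of s 0] by metis
  then show ?thesis by auto
qed

lemma max_free_le: "max_free s n \<le> card (smooth_nats s \<inter> {1..n})"
proof -
  obtain B where "B \<subseteq> smooth_nats s \<inter> {1..n}" "card B = max_free s n"
    using max_free_attained[of s n] by metis
  then show ?thesis by (metis card_mono finite_Int finite_atLeastAtMost)
qed

lemma max_free_mono: "a \<le> b \<Longrightarrow> max_free s a \<le> max_free s b"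
proof -
  assume "a \<le> b"
  obtain B where B: "B \<subseteq> smooth_nats s \<inter> {1..a}" "three_gp_free B" "card B = max_free s a"
    using max_free_attained[of s a] by metis
  have "B \<subseteq> smooth_nats s \<inter> {1..b}" using B(1) \<open>a \<le> b\<close> by auto
  then show ?thesis using card_le_max_free B by metis
qed

text \<open>Deleting \<open>Suc n\<close> from an optimal set leaves a candidate for the cutoff
  \<open>n\<close>.\<close>

lemma max_free_Suc_le: "max_free s (Suc n) \<le> Suc (max_free s n)"
proof -
  obtain B where B: "B \<subseteq> smooth_nats s \<inter> {1..Suc n}" "three_gp_free B"
      "card B = max_free s (Suc n)"
    using max_free_attained[of s "Suc n"] by metis
  have "B - {Suc n} \<subseteq> smooth_nats s \<inter> {1..n}"
    using B(1) by (auto simp: le_Suc_eq)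
  then have "card (B - {Suc n}) \<le> max_free s n"
    using three_gp_free_subset[OF B(2)] by (intro card_le_max_free) auto
  moreover have "card B \<le> Suc (card (B - {Suc n}))"
    using card_Diff1_le[of B "Suc n"] by (cases "Suc n \<in> B") (auto simp: card_Diff_singleton)
  ultimately show ?thesis using B by linarith
qed

lemma max_free_Suc_not_smooth:
  assumes "Suc n \<notin> smooth_nats s"
  shows "max_free s (Suc n) = max_free s n"
proof -
  have "smooth_nats s \<inter> {1..Suc n} = smooth_nats s \<inter> {1..n}"
    using assms by (auto simp: le_Suc_eq)
  then show ?thesis by (simp add: max_free_def)
qed

text \<open>For \<open>s \<ge> 2\<close> these are the numbers \<open>nth_smooth s j\<close> with
  \<open>j\<close> in \<open>stationary_indices s\<close>; working with values avoids the
  enumeration until the end.\<close>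

definition stationary_smooth :: "nat \<Rightarrow> nat set" where
  "stationary_smooth s = {t \<in> smooth_nats s. max_free s t = max_free s (t - 1)}"

text \<open>Each smooth number raises exactly one of the two terms on the left by one: the second if
  it is stationary, the first otherwise.\<close>

lemma max_free_eq_card:
  "max_free s n + card (stationary_smooth s \<inter> {1..n}) = card (smooth_nats s \<inter> {1..n})"
proof (induction n)
  case (Suc n)
  have step: "X \<inter> {1..Suc n} = (if Suc n \<in> X then insert (Suc n) (X \<inter> {1..n}) else X \<inter> {1..n})"
    for X :: "nat set"
    by (auto simp: le_Suc_eq)
  have "max_free s (Suc n) \<in> {max_free s n, Suc (max_free s n)}"
    using max_free_Suc_le[of s n] max_free_mono[of n "Suc n" s] by auto
  moreover have "Suc n \<in> stationary_smooth s \<longleftrightarrow>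
      Suc n \<in> smooth_nats s \<and> max_free s (Suc n) = max_free s n"
    by (simp add: stationary_smooth_def)
  ultimately show ?case
    unfolding step[of "stationary_smooth s"] step[of "smooth_nats s"]
    using Suc.IH max_free_Suc_not_smooth[of n s] by auto
qed (simp add: max_free_0)

section \<open>Translation between indices and smooth numbers\<close>

lemma nth_smooth_bij:
  assumes "s \<ge> 2"
  shows "bij_betw (nth_smooth s) {1..} (smooth_nats s)"
proof -
  have "bij_betw (\<lambda>j. j - 1) {1..} (UNIV :: nat set)"
    by (rule bij_betwI[of _ _ _ Suc]) auto
  from bij_betw_trans[OF this bij_enumerate[OF infinite_smooth_nats[OF assms]]]
  show ?thesis unfolding nth_smooth_def[abs_def] o_def .
qed

lemma nth_smooth_le_iff:
  assumes "s \<ge> 2" "1 \<le> i" "1 \<le> j"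
  shows "nth_smooth s i \<le> nth_smooth s j \<longleftrightarrow> i \<le> j"
  using assms infinite_smooth_nats[OF assms(1)] by (auto simp: nth_smooth_def)

lemma nth_smooth_image:
  assumes "s \<ge> 2" "1 \<le> j"
  shows "nth_smooth s ` {1..j} = smooth_nats s \<inter> {1..nth_smooth s j}"
proof (intro equalityI subsetI)
  fix x assume "x \<in> nth_smooth s ` {1..j}"
  then obtain i where i: "x = nth_smooth s i" "1 \<le> i" "i \<le> j" by auto
  then have "x \<in> smooth_nats s"
    using nth_smooth_bij[OF assms(1)] by (auto simp: bij_betw_def)
  then show "x \<in> smooth_nats s \<inter> {1..nth_smooth s j}"
    using i assms nth_smooth_le_iff[of s i j] smooth_nats_pos[of x s] by auto
next
  fix x assume x: "x \<in> smooth_nats s \<inter> {1..nth_smooth s j}"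
  then obtain i where "x = nth_smooth s i" "1 \<le> i"
    using nth_smooth_bij[OF assms(1)] by (auto simp: bij_betw_def)
  then show "x \<in> nth_smooth s ` {1..j}"
    using x assms nth_smooth_le_iff[of s i j] by auto
qed

text \<open>With this, \<open>m s (j - 1)\<close> is \<open>max_free\<close> at the cutoff just
  below \<open>nth_smooth s j\<close>, which is the comparison made in
  \<open>stationary_smooth\<close>.\<close>

lemma nth_smooth_image_pred:
  assumes "s \<ge> 2" "2 \<le> j"
  shows "nth_smooth s ` {1..j-1} = smooth_nats s \<inter> {1..nth_smooth s j - 1}"
proof -
  have "{1..j} = insert j {1..j-1}" using assms(2) by auto
  moreover have "nth_smooth s j \<notin> nth_smooth s ` {1..j-1}"
    using nth_smooth_bij[OF assms(1)] assms(2)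
    by (auto simp: bij_betw_def dest!: inj_onD)
  ultimately have "nth_smooth s ` {1..j-1} = nth_smooth s ` {1..j} - {nth_smooth s j}"
    by auto
  also have "\<dots> = smooth_nats s \<inter> {1..nth_smooth s j - 1}"
    using nth_smooth_image[of s j] assms by auto
  finally show ?thesis .
qed

lemma nth_smooth_bij_stationary:
  assumes "s \<ge> 2"
  shows "bij_betw (nth_smooth s) (stationary_indices s) (stationary_smooth s)"
proof -
  have iff: "nth_smooth s j \<in> stationary_smooth s \<longleftrightarrow> j \<in> stationary_indices s" if j: "1 \<le> j" for j
  proof (cases "2 \<le> j")
    case True
    then show ?thesis
      using j nth_smooth_image[OF assms j] nth_smooth_image_pred[OF assms True]
        nth_smooth_bij[OF assms]
      by (auto simp: stationary_smooth_def stationary_indices_def m_def max_free_def bij_betw_def)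
  next
    \<comment> \<open>Stationary indices start at 2, so the first smooth number must be kept out of
      \<open>stationary_smooth\<close>. It is 1, and there \<open>max_free\<close> rises from 0
      because a singleton is progression-free.\<close>
    case False
    then have [simp]: "j = 1" using j by simp
    have "smooth_nats s \<inter> {1..nth_smooth s 1} = {nth_smooth s 1}"
      using nth_smooth_image[OF assms, of 1] by simp
    moreover have "nth_smooth s 1 > 0"
      using nth_smooth_bij[OF assms] by (intro smooth_nats_pos[of _ s]) (auto simp: bij_betw_def)
    then have "1 \<in> smooth_nats s \<inter> {1..nth_smooth s 1}"
      using one_smooth by simp
    ultimately have 1: "nth_smooth s 1 = 1"
      by (metis singletonD)
    have "card {1::nat} \<le> max_free s 1"
      by (intro card_le_max_free) (use one_smooth in \<open>auto simp: three_gp_free_def\<close>)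
    then show ?thesis
      using 1 by (simp add: stationary_smooth_def stationary_indices_def max_free_0)
  qed
  have "stationary_indices s \<subseteq> {1..}" by (auto simp: stationary_indices_def)
  moreover have "nth_smooth s ` stationary_indices s = stationary_smooth s"
  proof (intro equalityI subsetI)
    fix t assume t: "t \<in> stationary_smooth s"
    then have "t \<in> smooth_nats s" by (simp add: stationary_smooth_def)
    then obtain j where "t = nth_smooth s j" "1 \<le> j"
      using nth_smooth_bij[OF assms] by (auto simp: bij_betw_def)
    then show "t \<in> nth_smooth s ` stationary_indices s" using t iff by blast
  next
    fix t assume "t \<in> nth_smooth s ` stationary_indices s"
    then show "t \<in> stationary_smooth s"
      using iff \<open>stationary_indices s \<subseteq> {1..}\<close> by force
  qed
  ultimately show ?thesis
    using bij_betw_subset[OF nth_smooth_bij[OF assms]] by metis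
qed

section \<open>Independence of the fibres and the value of \<open>g\<close>\<close>

definition fibre_union :: "nat \<Rightarrow> (nat \<Rightarrow> nat set) \<Rightarrow> nat set" where
  "fibre_union s B = {r * t | r t. r \<in> rough_nats s \<and> t \<in> B r}"

lemma mem_fibre_union_iff:
  assumes "r \<in> rough_nats s" "t \<in> smooth_nats s" "\<And>r. B r \<subseteq> smooth_nats s"
  shows "r * t \<in> fibre_union s B \<longleftrightarrow> t \<in> B r"
  using assms rough_smooth_unique[of r s _ t] unfolding fibre_union_def by blast

text \<open>A ratio of smooth numbers cannot change the rough part, so a progression in the union
  would lie in one fibre, and its smooth parts would form a progression there.\<close>

lemma gp_free_fibre_union:
  assumes B: "\<And>r. B r \<subseteq> smooth_nats s" "\<And>r. three_gp_free (B r)"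
  shows "\<not> contains_smooth_ratio_gp s (fibre_union s B)"
proof
  assume "contains_smooth_ratio_gp s (fibre_union s B)"
  then obtain a b c u v and k :: rat where
    abc: "a \<in> fibre_union s B" "b \<in> fibre_union s B" "c \<in> fibre_union s B" "0 < a"
    and uv: "u \<in> smooth_nats s" "v \<in> smooth_nats s"
    and k: "1 < k" "k = of_nat u / of_nat v"
    and bc: "of_nat b = of_nat a * k" "of_nat c = of_nat a * k ^ 2"
    unfolding contains_smooth_ratio_gp_def by blast
  obtain r1 t1 r2 t2 r3 t3 where
    r: "r1 \<in> rough_nats s" "r2 \<in> rough_nats s" "r3 \<in> rough_nats s"
    and t: "t1 \<in> B r1" "t2 \<in> B r2" "t3 \<in> B r3"
    and eqs: "a = r1 * t1" "b = r2 * t2" "c = r3 * t3"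
    using abc unfolding fibre_union_def by blast
  have ts: "t1 \<in> smooth_nats s" "t2 \<in> smooth_nats s" "t3 \<in> smooth_nats s"
    using t B by blast+
  have v: "v > 0" using uv smooth_nats_pos by blast
  \<comment> \<open>Clearing denominators gives an equation in the naturals, to which unique
    factorisation applies with smooth parts \<open>t2 * v\<close> and \<open>t1 * u\<close>.\<close>
  have "(of_nat (b * v) :: rat) = of_nat (a * u)"
    using bc k v by simp
  then have "r2 * (t2 * v) = r1 * (t1 * u)"
    unfolding of_nat_eq_iff eqs by (simp add: mult_ac)
  from rough_smooth_unique[OF r(2,1) smooth_mult smooth_mult this]
  have 2: "r2 = r1" "t2 * v = t1 * u"
    using ts uv by simp_all
  have "(of_nat (c * (v * v)) :: rat) = of_nat (a * (u * u))"
    using bc k v by (simp add: power2_eq_square)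
  then have "r3 * (t3 * (v * v)) = r1 * (t1 * (u * u))"
    unfolding of_nat_eq_iff eqs by (simp add: mult_ac)
  from rough_smooth_unique[OF r(3,1) smooth_mult smooth_mult this]
  have 3: "r3 = r1" "t3 * (v * v) = t1 * (u * u)"
    using ts uv by (simp_all add: smooth_mult)
  have "(t1 * t3) * (v * v) = t2 ^ 2 * (v * v)"
  proof -
    have "t2 ^ 2 * (v * v) = (t2 * v) * (t2 * v)" by (simp add: power2_eq_square)
    also have "\<dots> = t1 * (t1 * (u * u))" unfolding 2(2) by simp
    also have "\<dots> = t1 * t3 * (v * v)" unfolding 3(2)[symmetric] by simp
    finally show ?thesis by (rule sym)
  qed
  then have gp: "t1 * t3 = t2 ^ 2" using v by simp
  \<comment> \<open>The ratio exceeds 1, so \<open>t1 < t2 < t3\<close>; this supplies the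
    distinctness asked for by \<open>three_gp_free\<close>.\<close>
  have "u > v" using k v by (simp add: divide_simps)
  then have "t1 * v < t2 * v" using 2(2) smooth_nats_pos[OF ts(1)] by simp
  then have "t1 < t2" by simp
  then have "t1 * t2 < t1 * t3"
    unfolding gp using smooth_nats_pos[OF ts(1)] by (simp add: power2_eq_square)
  then have "t2 < t3" by simp
  then show False
    using gp \<open>t1 < t2\<close> t B(2)[of r1] 2(1) 3(1) unfolding three_gp_free_def
    by (metis less_trans less_irrefl)
qed

text \<open>Conversely, if \<open>x * z = y ^ 2\<close> in a fibre with \<open>x < y\<close>, then
  \<open>r * x\<close>, \<open>r * y\<close>, \<open>r * z\<close> form a progression in
  \<open>A\<close> whose ratio \<open>y / x\<close> is a quotient of smooth numbers.\<close>

lemma three_gp_free_fibre: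
  assumes "\<not> contains_smooth_ratio_gp s A" "r > 0"
  shows "three_gp_free {t \<in> smooth_nats s \<inter> X. r * t \<in> A}"
proof -
  let ?F = "{t \<in> smooth_nats s \<inter> X. r * t \<in> A}"
  have False if "x \<in> ?F" "y \<in> ?F" "z \<in> ?F" "x < y" "x * z = y ^ 2" for x y z
  proof -
    have x: "x > 0" using that smooth_nats_pos by blast
    have "(of_nat x :: rat) * of_nat z = of_nat y ^ 2"
      by (metis that(5) of_nat_mult of_nat_power)
    then have "(of_nat (r * z) :: rat) = of_nat (r * x) * (of_nat y / of_nat x) ^ 2"
      using x by (simp add: field_simps power2_eq_square)
    moreover have "(of_nat (r * y) :: rat) = of_nat (r * x) * (of_nat y / of_nat x)"
      using x by simp
    moreover have "(1 :: rat) < of_nat y / of_nat x"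
      using x that by simp
    ultimately have "0 < r * x \<and> 1 < (of_nat y / of_nat x :: rat) \<and>
        (of_nat y / of_nat x :: rat) = of_nat y / of_nat x \<and>
        (of_nat (r * y) :: rat) = of_nat (r * x) * (of_nat y / of_nat x) \<and>
        (of_nat (r * z) :: rat) = of_nat (r * x) * (of_nat y / of_nat x) ^ 2"
      using x assms(2) by simp
    moreover have "x \<in> smooth_nats s" "y \<in> smooth_nats s" "r * x \<in> A" "r * y \<in> A" "r * z \<in> A"
      using that by auto
    ultimately have "contains_smooth_ratio_gp s A"
      unfolding contains_smooth_ratio_gp_def by blast
    then show False using assms by simp
  qed
  note key = this
  \<comment> \<open>\<open>three_gp_free\<close> does not order its terms. One outer term lies below
    the middle one, and exchanging the outer terms reduces to the increasing case.\<close>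
  have less: "x < y \<or> z < y" if "x * z = y ^ 2" "x \<noteq> y" "z \<noteq> y" for x y z :: nat
  proof (rule ccontr)
    assume "\<not> (x < y \<or> z < y)"
    then have "y < x" "y < z" using that by auto
    then have "y * y < x * z" by (intro mult_strict_mono) auto
    then show False using that by (simp add: power2_eq_square)
  qed
  show ?thesis
    unfolding three_gp_free_def
  proof (intro notI, elim bexE conjE)
    fix x y z assume xyz: "x \<in> ?F" "y \<in> ?F" "z \<in> ?F" "x \<noteq> y" "y \<noteq> z" "x * z = y ^ 2"
    then consider "x < y" | "z < y" using less by blast
    then show False
      using key[of x y z] key[of z y x] xyz by cases (simp_all add: mult.commute)
  qed
qed

text \<open>\<open>A\<close> may be infinite here, so that the bound serves both \<open>g\<close>
  and the upper density.\<close>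

lemma card_gp_free_le:
  assumes "A \<subseteq> {1..}" "\<not> contains_smooth_ratio_gp s A"
  shows "card (A \<inter> {1..N}) \<le> (\<Sum>r\<in>rough_nats s \<inter> {1..N}. max_free s (N div r))"
  unfolding card_rough_fibres[OF assms(1), of N s]
  by (intro sum_mono card_le_max_free three_gp_free_fibre assms) auto

lemma finite_gp_free_cards:
  "finite {card A | A. A \<subseteq> {1..N} \<and> \<not> contains_smooth_ratio_gp s A}"
  by (rule finite_card_subsets) simp

lemma card_fibre_union:
  assumes "\<And>r. B r \<subseteq> smooth_nats s"
  shows "card (fibre_union s B \<inter> {1..N}) = (\<Sum>r\<in>rough_nats s \<inter> {1..N}. card (B r \<inter> {1..N div r}))"
proof -
  have "fibre_union s B \<subseteq> {1..}"
    using assms rough_nats_pos smooth_nats_pos unfolding fibre_union_def by fastforce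
  moreover have "{t \<in> smooth_nats s \<inter> {1..N div r}. r * t \<in> fibre_union s B} = B r \<inter> {1..N div r}"
    if "r \<in> rough_nats s" for r
    using mem_fibre_union_iff[where B = B, OF that _ assms] assms by auto
  ultimately show ?thesis
    by (subst card_rough_fibres[of _ _ s]) (auto intro!: sum.cong arg_cong[of _ _ card])
qed

text \<open>The fibrewise bound is attained by gluing, over each rough \<open>r\<close>, an optimal
  set for the cutoff \<open>N div r\<close>.\<close>

lemma g_eq_sum: "g s N = (\<Sum>r\<in>rough_nats s \<inter> {1..N}. max_free s (N div r))"
proof (rule antisym)
  have "{} \<in> {A. A \<subseteq> {1..N} \<and> \<not> contains_smooth_ratio_gp s A}"
    by (auto simp: contains_smooth_ratio_gp_def)
  then have "{card A | A. A \<subseteq> {1..N} \<and> \<not> contains_smooth_ratio_gp s A} \<noteq> {}" by blast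
  from Max_in[OF finite_gp_free_cards this]
  obtain A where A: "g s N = card A" "A \<subseteq> {1..N}" "\<not> contains_smooth_ratio_gp s A"
    unfolding g_def by blast
  then show "g s N \<le> (\<Sum>r\<in>rough_nats s \<inter> {1..N}. max_free s (N div r))"
    using card_gp_free_le[of A s N] by (simp add: Int_absorb2 subset_eq)
next
  have "\<forall>n. \<exists>B. B \<subseteq> smooth_nats s \<inter> {1..n} \<and> three_gp_free B \<and> card B = max_free s n"
    using max_free_attained by metis
  then obtain B where B: "\<And>n. B n \<subseteq> smooth_nats s \<inter> {1..n}" "\<And>n. three_gp_free (B n)"
      "\<And>n. card (B n) = max_free s n"
    by metis
  let ?U = "fibre_union s (\<lambda>r. B (N div r))"
  have "\<not> contains_smooth_ratio_gp s ?U"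
    using B by (intro gp_free_fibre_union) auto
  then have "\<not> contains_smooth_ratio_gp s (?U \<inter> {1..N})"
    unfolding contains_smooth_ratio_gp_def by blast
  then have "card (?U \<inter> {1..N}) \<le> g s N"
    unfolding g_def by (intro Max_ge finite_gp_free_cards) auto
  moreover have "card (?U \<inter> {1..N}) = (\<Sum>r\<in>rough_nats s \<inter> {1..N}. max_free s (N div r))"
    using B by (subst card_fibre_union) (auto simp: Int_absorb2 intro!: sum.cong)
  ultimately show "(\<Sum>r\<in>rough_nats s \<inter> {1..N}. max_free s (N div r)) \<le> g s N" by simp
qed

section \<open>Double counting and the sum of reciprocals\<close>

text \<open>Both sides count the pairs \<open>r \<in> Y\<close>, \<open>t \<in> X\<close> of
  positive integers with \<open>r * t \<le> N\<close>.\<close>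

lemma sum_card_swap:
  "(\<Sum>r\<in>Y \<inter> {1..N}. card (X \<inter> {1..N div r})) = (\<Sum>t\<in>X \<inter> {1..N}. card (Y \<inter> {1..N div t}))"
  for X Y :: "nat set"
proof -
  have *: "X \<inter> {1..N div r} = {t. t \<in> X \<inter> {1..N} \<and> r * t \<le> N}" if "r > 0" for r and X :: "nat set"
  proof -
    have "t \<le> N" if "r * t \<le> N" for t
      using that \<open>r > 0\<close> le_trans[of t "r * t" N] by simp
    then show ?thesis
      using that by (auto simp: less_eq_div_iff_mult_less_eq mult.commute)
  qed
  have "(\<Sum>r\<in>Y \<inter> {1..N}. card (X \<inter> {1..N div r}))
      = (\<Sum>r\<in>Y \<inter> {1..N}. \<Sum>t | t \<in> X \<inter> {1..N} \<and> r * t \<le> N. 1)"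
    by (intro sum.cong) (use *[of _ X] in auto)
  also have "\<dots> = (\<Sum>t\<in>X \<inter> {1..N}. \<Sum>r | r \<in> Y \<inter> {1..N} \<and> r * t \<le> N. 1)"
    by (rule sum.swap_restrict) auto
  also have "\<dots> = (\<Sum>t\<in>X \<inter> {1..N}. card (Y \<inter> {1..N div t}))"
    by (intro sum.cong) (use *[of _ Y] in \<open>auto simp: mult.commute\<close>)
  finally show ?thesis .
qed

text \<open>The fibre count applied to the set of all positive integers.\<close>

lemma sum_card_smooth: "(\<Sum>r\<in>rough_nats s \<inter> {1..N}. card (smooth_nats s \<inter> {1..N div r})) = N"
proof -
  have "{t \<in> smooth_nats s \<inter> {1..N div r}. r * t \<in> {1..}} = smooth_nats s \<inter> {1..N div r}"
    if "r \<in> rough_nats s" for r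
    using rough_nats_pos[OF that] by auto
  then have "(\<Sum>r\<in>rough_nats s \<inter> {1..N}. card (smooth_nats s \<inter> {1..N div r}))
      = card ({1..} \<inter> {1..N})"
    by (subst card_rough_fibres[of _ _ s]) (auto intro!: sum.cong arg_cong[of _ _ card])
  also have "{1..} \<inter> {1..N} = {1..N}" by auto
  finally show ?thesis by simp
qed

text \<open>After the swap both sums run over \<open>r\<close>, and \<open>max_free_eq_card\<close>
  at \<open>N div r\<close> merges them into the count of all smooth numbers in the fibre.\<close>

lemma g_plus_stationary:
  "g s N + (\<Sum>t\<in>stationary_smooth s \<inter> {1..N}. card (rough_nats s \<inter> {1..N div t})) = N"
  unfolding sum_card_swap[of "stationary_smooth s" N "rough_nats s", symmetric]
    g_eq_sum sum.distrib[symmetric] max_free_eq_card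
  by (rule sum_card_smooth)

text \<open>For finitely many smooth \<open>t\<close>, the products \<open>r * t \<le> N\<close>
  with rough \<open>r\<close> number at most \<open>N\<close>. Dividing by \<open>N\<close> and
  letting it grow bounds \<open>rough_density s\<close> times the sum of reciprocals by 1.\<close>

lemma summable_on_smooth: "(\<lambda>t. 1 / real t) summable_on smooth_nats s"
proof (rule nonneg_bdd_above_summable_on)
  let ?c = "\<lambda>n. real (card (rough_nats s \<inter> {1..n}))"
  have "(\<Sum>t\<in>F. 1 / real t) \<le> 1 / rough_density s" if F: "F \<subseteq> smooth_nats s" "finite F" for F
  proof -
    have lim: "(\<lambda>N. \<Sum>t\<in>F. ?c (N div t) / real N) \<longlonglongrightarrow> (\<Sum>t\<in>F. rough_density s / real t)"
      using F by (intro tendsto_sum tendsto_card_rough_div smooth_nats_pos) auto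
    have le: "(\<Sum>t\<in>F. ?c (N div t) / real N) \<le> 1" for N
    proof -
      \<comment> \<open>Terms with \<open>t > N\<close> vanish, since then
        \<open>N div t = 0\<close>.\<close>
      have "(\<Sum>t\<in>F. ?c (N div t)) = (\<Sum>t\<in>F \<inter> {1..N}. ?c (N div t))"
        using F smooth_nats_pos by (intro sum.mono_neutral_right) (auto simp: Suc_le_eq not_le)
      also have "\<dots> \<le> (\<Sum>t\<in>smooth_nats s \<inter> {1..N}. ?c (N div t))"
        using F by (intro sum_mono2) auto
      also have "\<dots> = real (\<Sum>t\<in>smooth_nats s \<inter> {1..N}. card (rough_nats s \<inter> {1..N div t}))"
        by simp
      also have "\<dots> = real N"
        by (simp only: sum_card_smooth flip: sum_card_swap)
      finally show ?thesis
        by (cases "N = 0") (simp_all flip: sum_divide_distrib)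
    qed
    have "(\<Sum>t\<in>F. rough_density s / real t) \<le> 1"
      using LIMSEQ_le_const2[OF lim] le by blast
    then have "rough_density s * (\<Sum>t\<in>F. 1 / real t) \<le> 1"
      by (simp add: sum_distrib_left)
    then show ?thesis
      using rough_density_pos[of s] by (simp add: field_simps)
  qed
  then show "bdd_above (sum (\<lambda>t. 1 / real t) ` {F. F \<subseteq> smooth_nats s \<and> finite F})"
    by (auto intro!: bdd_aboveI[of _ "1 / rough_density s"])
qed auto

section \<open>Dominated convergence and the limit of \<open>g s N / N\<close>\<close>

text \<open>Tannery's theorem after extension by zero from \<open>J\<close> to all naturals;
  \<open>vanish\<close> turns the infinite sum at stage \<open>N\<close> into the finite
  one.\<close>

lemma tendsto_sum_dominated:
  fixes h :: "nat \<Rightarrow> nat \<Rightarrow> real"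
  assumes J: "J \<subseteq> {1..}" "w summable_on J"
    and lim: "\<And>t. t \<in> J \<Longrightarrow> (\<lambda>N. h t N) \<longlonglongrightarrow> b t"
    and bound: "\<And>t N. t \<in> J \<Longrightarrow> \<bar>h t N\<bar> \<le> w t"
    and b: "(b has_sum L) J"
    and vanish: "\<And>t N. t \<in> J \<Longrightarrow> N < t \<Longrightarrow> h t N = 0"
  shows "(\<lambda>N. \<Sum>t\<in>J \<inter> {1..N}. h t N) \<longlonglongrightarrow> L"
proof -
  let ?x = "\<lambda>f t. if t \<in> J then f t else (0::real)"
  have "(?x w) summable_on UNIV"
    using J(2) by (subst summable_on_cong_neutral[of J _ w]) auto
  then have "summable (?x w)" by (rule summable_on_imp_summable)
  then have "(\<lambda>N. \<Sum>t. if t \<in> J then h t N else 0) \<longlonglongrightarrow> suminf (?x b)"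
    using lim bound
    by (intro conjunct2[OF conjunct2[OF tannerys_theorem[where M = "?x w"]]])
       (auto intro!: always_eventually)
  moreover have "(\<Sum>t. if t \<in> J then h t N else 0) = (\<Sum>t\<in>J \<inter> {1..N}. h t N)" for N
    using J(1) vanish by (subst suminf_finite[of "J \<inter> {1..N}"]) (auto simp: not_le)
  moreover have "((?x b) has_sum L) UNIV"
    using b by (subst has_sum_cong_neutral[of J _ b]) auto
  then have "suminf (?x b) = L"
    using has_sum_imp_sums sums_unique by metis
  ultimately show ?thesis by simp
qed

lemma tendsto_card_over_n:
  fixes X :: "nat set"
  assumes "X \<subseteq> {1..}" "(\<lambda>t. 1 / real t) summable_on X"
  shows "(\<lambda>n. real (card (X \<inter> {1..n})) / real n) \<longlonglongrightarrow> 0"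
proof -
  \<comment> \<open>The quotient is written as a sum over \<open>t\<close>, each term tending to 0
    and dominated by \<open>1 / t\<close>.\<close>
  have "(\<lambda>n. \<Sum>t\<in>X \<inter> {1..n}. if t \<le> n then 1 / real n else 0) \<longlonglongrightarrow> 0"
  proof (rule tendsto_sum_dominated[OF assms, where b = "\<lambda>_. 0"])
    show "(\<lambda>n. if t \<le> n then 1 / real n else 0) \<longlonglongrightarrow> 0" for t
      by (rule tendsto_cong[THEN iffD1, OF _ lim_1_over_n])
         (auto intro: eventually_mono[OF eventually_ge_at_top[of t]])
    show "\<bar>if t \<le> n then 1 / real n else 0\<bar> \<le> 1 / real t" if "t \<in> X" for t n
      using assms(1) that by (auto simp: frac_le)
  qed auto
  then show ?thesis by simp
qed

lemma stationary_smooth_subset: "stationary_smooth s \<subseteq> smooth_nats s"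
  by (auto simp: stationary_smooth_def)

lemma smooth_nats_subset: "smooth_nats s \<subseteq> {1..}"
  by (auto simp: smooth_nats_def)

lemma summable_on_stationary: "(\<lambda>t. 1 / real t) summable_on stationary_smooth s"
  by (rule summable_on_subset_banach[OF summable_on_smooth stationary_smooth_subset])

lemma tendsto_g:
  "(\<lambda>N. real (g s N) / real N) \<longlonglongrightarrow>
    1 - rough_density s * (\<Sum>\<^sub>\<infinity>t\<in>stationary_smooth s. 1 / real t)" (is "_ \<longlonglongrightarrow> 1 - ?L")
proof -
  let ?J = "stationary_smooth s"
  let ?h = "\<lambda>t N. real (card (rough_nats s \<inter> {1..N div t})) / real N"
  have J: "?J \<subseteq> {1..}" using stationary_smooth_subset smooth_nats_subset by blast
  have "(\<lambda>N. \<Sum>t\<in>?J \<inter> {1..N}. ?h t N) \<longlonglongrightarrow> ?L"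
  proof (rule tendsto_sum_dominated[OF J summable_on_stationary])
    show "(\<lambda>N. ?h t N) \<longlonglongrightarrow> rough_density s * (1 / real t)" if "t \<in> ?J" for t
      using tendsto_card_rough_div[of t s] J that by auto
    show "((\<lambda>t. rough_density s * (1 / real t)) has_sum ?L) ?J"
      by (intro has_sum_cmult_right has_sum_infsum summable_on_stationary)
    \<comment> \<open>There are at most \<open>N div t\<close> rough integers to count; for
      \<open>N = 0\<close> the quotient is 0 by the convention on division by zero.\<close>
    show "\<bar>?h t N\<bar> \<le> 1 / real t" if "t \<in> ?J" for t N
    proof -
      have t: "t > 0" using J that by auto
      have "card (rough_nats s \<inter> {1..N div t}) \<le> N div t"
        using card_mono[of "{1..N div t}" "rough_nats s \<inter> {1..N div t}"] by auto
      then have "real (card (rough_nats s \<inter> {1..N div t})) \<le> real N / real t"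
        using real_div_nat_bounds(1)[OF t, of N] by linarith
      then show ?thesis
        by (cases "N = 0") (auto simp: field_simps)
    qed
  qed auto
  then have "(\<lambda>N. 1 - (\<Sum>t\<in>?J \<inter> {1..N}. ?h t N)) \<longlonglongrightarrow> 1 - ?L"
    by (intro tendsto_diff tendsto_const)
  moreover have "\<forall>\<^sub>F N in sequentially. 1 - (\<Sum>t\<in>?J \<inter> {1..N}. ?h t N) = real (g s N) / real N"
    using eventually_gt_at_top[of 0]
  proof eventually_elim
    case (elim N)
    have "real (g s N) + (\<Sum>t\<in>?J \<inter> {1..N}. real (card (rough_nats s \<inter> {1..N div t}))) = real N"
      using arg_cong[OF g_plus_stationary[of s N], of real] by simp
    then show ?case
      using elim by (simp add: field_simps flip: sum_divide_distrib)
  qed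
  ultimately show ?thesis by (rule Lim_transform_eventually)
qed

section \<open>The limit as a supremum of upper densities\<close>

lemma upper_density_le_lim_g:
  assumes "A \<subseteq> {1..}" "\<not> contains_smooth_ratio_gp s A"
    and lim: "(\<lambda>N. real (g s N) / real N) \<longlonglongrightarrow> \<alpha>"
  shows "upper_density A \<le> ereal \<alpha>"
proof -
  have "upper_density A \<le> limsup (\<lambda>N. ereal (real (g s N) / real N))"
    unfolding upper_density_def g_eq_sum
    by (intro Limsup_mono always_eventually allI)
       (simp add: divide_right_mono card_gp_free_le[OF assms(1,2), simplified] del: of_nat_sum)
  also have "\<dots> = ereal \<alpha>"
    using lim by (intro lim_imp_Limsup) auto
  finally show ?thesis .
qed

text \<open>Smooth numbers have density 0 because their reciprocals are summable, so for a given
  \<open>f i\<close> every large enough value will do for \<open>f (Suc i)\<close>.\<close>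

lemma ex_sparse_sequence:
  obtains f :: "nat \<Rightarrow> nat" where "strict_mono f"
    "\<And>i. real (f i) * (real (card (smooth_nats s \<inter> {1..f (Suc i)})) / real (f (Suc i))) \<le> 1 / real (Suc i)"
proof -
  let ?d = "\<lambda>n. real (card (smooth_nats s \<inter> {1..n})) / real n"
  have "\<exists>n. c < n \<and> real c * ?d n \<le> 1 / real (Suc i)" for c i
  proof -
    have "(\<lambda>n. real c * ?d n) \<longlonglongrightarrow> real c * 0"
      by (intro tendsto_intros tendsto_card_over_n summable_on_smooth smooth_nats_subset)
    then have "\<forall>\<^sub>F n in sequentially. real c * ?d n < 1 / real (Suc i)"
      by (rule order_tendstoD) simp
    then have "\<forall>\<^sub>F n in sequentially. c < n \<and> real c * ?d n \<le> 1 / real (Suc i)"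
      using eventually_gt_at_top[of c] by eventually_elim simp
    then show ?thesis by (rule eventually_happens'[OF sequentially_bot])
  qed
  then obtain f where "\<And>i. f i < f (Suc i) \<and> real (f i) * ?d (f (Suc i)) \<le> 1 / real (Suc i)"
    using dependent_nat_choice[of "\<lambda>_ _. True" "\<lambda>i c n. c < n \<and> real c * ?d n \<le> 1 / real (Suc i)"]
    by auto
  then show thesis using that[of f] by (auto simp: strict_mono_Suc_iff)
qed

lemma ex_gp_free_dense:
  assumes lim: "(\<lambda>N. real (g s N) / real N) \<longlonglongrightarrow> \<alpha>"
  shows "\<exists>A. A \<subseteq> {1..} \<and> \<not> contains_smooth_ratio_gp s A \<and> ereal \<alpha> \<le> upper_density A"
proof -
  obtain f where f: "strict_mono f"
    "\<And>i. real (f i) * (real (card (smooth_nats s \<inter> {1..f (Suc i)})) / real (f (Suc i))) \<le> 1 / real (Suc i)"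
    using ex_sparse_sequence by blast
  have "\<forall>n. \<exists>B. B \<subseteq> smooth_nats s \<inter> {1..n} \<and> three_gp_free B \<and> card B = max_free s n"
    using max_free_attained by metis
  then obtain B where B: "\<And>n. B n \<subseteq> smooth_nats s \<inter> {1..n}" "\<And>n. three_gp_free (B n)"
      "\<And>n. card (B n) = max_free s n"
    by metis
  \<comment> \<open>The least \<open>i\<close> with \<open>r \<le> f i\<close> is the stage of
    \<open>r\<close>, and the fibre over \<open>r\<close> is optimised for the cutoff of that stage
    only.\<close>
  define D where "D r = B (f (LEAST i. r \<le> f i) div r)" for r
  have D: "D r \<subseteq> smooth_nats s" "three_gp_free (D r)" for r
    using B by (auto simp: D_def)
  define A where "A = fibre_union s D"
  have "A \<subseteq> {1..}"
    unfolding A_def using D(1) rough_nats_pos smooth_nats_pos unfolding fibre_union_def by fastforce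
  have free: "\<not> contains_smooth_ratio_gp s A"
    unfolding A_def by (rule gp_free_fibre_union[OF D])
  \<comment> \<open>The fibres with \<open>r \<le> f i\<close> were tuned to earlier cutoffs and are
    given up. There are at most \<open>f i\<close> of them, each worth at most the number of smooth
    integers up to \<open>f (Suc i)\<close>.\<close>
  have count: "g s (f (Suc i)) \<le> card (A \<inter> {1..f (Suc i)})
      + f i * card (smooth_nats s \<inter> {1..f (Suc i)})" for i
  proof -
    let ?N = "f (Suc i)"
    let ?R1 = "rough_nats s \<inter> {1..f i}" and ?R2 = "rough_nats s \<inter> {f i<..?N}"
    have "f i < ?N" using f(1) by (simp add: strict_mono_Suc_iff)
    have split: "rough_nats s \<inter> {1..?N} = ?R1 \<union> ?R2"
      using \<open>f i < ?N\<close> rough_nats_pos[of _ s] by (auto simp: Suc_le_eq)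
    have "g s ?N = (\<Sum>r\<in>?R1. max_free s (?N div r)) + (\<Sum>r\<in>?R2. max_free s (?N div r))"
      unfolding g_eq_sum split by (rule sum.union_disjoint) auto
    also have "(\<Sum>r\<in>?R1. max_free s (?N div r)) \<le> card ?R1 * card (smooth_nats s \<inter> {1..?N})"
    proof -
      have "max_free s (?N div r) \<le> card (smooth_nats s \<inter> {1..?N})" for r
        by (rule le_trans[OF max_free_mono max_free_le]) simp
      then show ?thesis
        using sum_bounded_above[of ?R1 "\<lambda>r. max_free s (?N div r)"] by simp
    qed
    also have "card ?R1 * card (smooth_nats s \<inter> {1..?N}) \<le> f i * card (smooth_nats s \<inter> {1..?N})"
      using card_mono[of "{1..f i}" ?R1] by (intro mult_right_mono) auto
    also have "(\<Sum>r\<in>?R2. max_free s (?N div r)) = (\<Sum>r\<in>?R2. card (D r \<inter> {1..?N div r}))"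
    proof (rule sum.cong[OF refl])
      fix r assume r: "r \<in> ?R2"
      \<comment> \<open>For \<open>f i < r \<le> f (Suc i)\<close> the stage is
        \<open>Suc i\<close>, so the fibre is optimal for exactly the cutoff at hand.\<close>
      have "(LEAST i. r \<le> f i) = Suc i"
      proof (rule Least_equality)
        show "Suc i \<le> j" if "r \<le> f j" for j
        proof (rule ccontr)
          assume "\<not> Suc i \<le> j"
          then have "f j \<le> f i" using f(1) by (simp add: strict_mono_less_eq)
          then show False using r that by simp
        qed
      qed (use r in simp)
      then show "max_free s (?N div r) = card (D r \<inter> {1..?N div r})"
        using B by (simp add: D_def Int_absorb2)
    qed
    also have "\<dots> \<le> (\<Sum>r\<in>rough_nats s \<inter> {1..?N}. card (D r \<inter> {1..?N div r}))"
      unfolding split by (rule sum_mono2) auto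
    also have "\<dots> = card (A \<inter> {1..?N})"
      unfolding A_def by (rule card_fibre_union[OF D(1), symmetric])
    finally show ?thesis by simp
  qed
  let ?a = "\<lambda>N. real (card (A \<inter> {1..N})) / real N"
  have "real (g s (f (Suc i))) / real (f (Suc i)) - 1 / real (Suc i) \<le> ?a (f (Suc i))" for i
  proof -
    let ?N = "f (Suc i)"
    have "real (g s ?N) \<le> real (card (A \<inter> {1..?N})) + real (f i) * real (card (smooth_nats s \<inter> {1..?N}))"
      using count[of i] by (simp flip: of_nat_mult of_nat_add)
    then have "real (g s ?N) / real ?N \<le> ?a ?N + real (f i) * (real (card (smooth_nats s \<inter> {1..?N})) / real ?N)"
      by (auto dest: divide_right_mono[of _ _ "real ?N"] simp: add_divide_distrib)
    then show ?thesis using f(2)[of i] by linarith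
  qed
  note lower = this
  have mono: "strict_mono (\<lambda>i. f (Suc i))"
    using f(1) by (simp add: strict_mono_Suc_iff)
  have "(\<lambda>i. real (g s (f (Suc i))) / real (f (Suc i)) - 1 / real (Suc i)) \<longlonglongrightarrow> \<alpha> - 0"
    using LIMSEQ_subseq_LIMSEQ[OF lim mono] LIMSEQ_inverse_real_of_nat
    by (intro tendsto_diff) (simp_all add: o_def inverse_eq_divide)
  \<comment> \<open>A lower bound along the subsequence suffices, as its limsup is at most that of
    the whole sequence.\<close>
  then have "ereal \<alpha> = limsup (\<lambda>i. ereal (real (g s (f (Suc i))) / real (f (Suc i)) - 1 / real (Suc i)))"
    by (intro lim_imp_Limsup[symmetric]) auto
  also have "\<dots> \<le> limsup ((\<lambda>N. ereal (?a N)) \<circ> (\<lambda>i. f (Suc i)))"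
    using lower by (intro Limsup_mono always_eventually) auto
  also have "\<dots> \<le> upper_density A"
    unfolding upper_density_def by (rule limsup_subseq_mono[OF mono])
  finally show ?thesis using \<open>A \<subseteq> {1..}\<close> free by blast
qed

theorem theorem4p2:
  fixes s :: nat
  assumes "s \<ge> 2"
  shows "\<exists>\<alpha>::real.
    (\<lambda>N. real (g s N) / real N) \<longlonglongrightarrow> \<alpha> \<and>
    (\<lambda>j. 1 / real (nth_smooth s j)) summable_on stationary_indices s \<and>
    \<alpha> = 1 - (\<Prod>p\<in>{p::nat. prime p \<and> p \<le> s}. (real p - 1) / real p) *
            (\<Sum>\<^sub>\<infinity>j\<in>stationary_indices s. 1 / real (nth_smooth s j)) \<and>
    ereal \<alpha> = Sup {upper_density A | A. A \<subseteq> {1..} \<and> \<not> contains_smooth_ratio_gp s A}"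
proof -
  note bij = nth_smooth_bij_stationary[OF assms]
  define \<alpha> where "\<alpha> = 1 - rough_density s * (\<Sum>\<^sub>\<infinity>t\<in>stationary_smooth s. 1 / real t)"
  have lim: "(\<lambda>N. real (g s N) / real N) \<longlonglongrightarrow> \<alpha>"
    unfolding \<alpha>_def by (rule tendsto_g)
  have "(\<lambda>j. 1 / real (nth_smooth s j)) summable_on stationary_indices s"
    using summable_on_reindex_bij_betw[OF bij, of "\<lambda>t. 1 / real t"] summable_on_stationary by simp
  moreover have "\<alpha> = 1 - (\<Prod>p\<in>{p::nat. prime p \<and> p \<le> s}. (real p - 1) / real p) *
            (\<Sum>\<^sub>\<infinity>j\<in>stationary_indices s. 1 / real (nth_smooth s j))"
    using infsum_reindex_bij_betw[OF bij, of "\<lambda>t. 1 / real t"]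
    by (simp add: \<alpha>_def rough_density_def)
  moreover have "ereal \<alpha> = Sup {upper_density A | A. A \<subseteq> {1..} \<and> \<not> contains_smooth_ratio_gp s A}"
  \<comment> \<open>The supremum is attained, by the set built along the sparse sequence.\<close>
  proof (rule antisym)
    obtain A where "A \<subseteq> {1..}" "\<not> contains_smooth_ratio_gp s A" "ereal \<alpha> \<le> upper_density A"
      using ex_gp_free_dense[OF lim] by blast
    then show "ereal \<alpha> \<le> Sup {upper_density A | A. A \<subseteq> {1..} \<and> \<not> contains_smooth_ratio_gp s A}"
      by (intro Sup_upper2[of "upper_density A"]) auto
  qed (use upper_density_le_lim_g[OF _ _ lim] in \<open>auto intro!: Sup_least\<close>)
  ultimately show ?thesis using lim by blast
qed

end
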